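(* Let $G(q)=\sum_{k=1}^{\infty}\sigma(k)q^{k}\in\mathbf{Z}[[q]]$, where $\sigma(k)=\sum_{d\mid k}d$ is the sum of the positive divisors of $k$, and let $D=q\frac{d}{dq}$. Then \[ 7G^{2}-G+DG\equiv 0\pmod{10}, \] i.e. every coefficient of the formal power series $7G^{2}-G+DG$ is divisible by $10$.
   Context: All series are formal power series in $q$ with integer coefficients; $D=q\frac{d}{dq}$ acts termwise, $D\left(\sum_k a_kq^k\right)=\sum_k k a_kq^k$. Congruence of power series modulo an integer means coefficientwise congruence. *)

theory Defs
  imports "HOL-Number_Theory.Number_Theory" "HOL-Computational_Algebra.Formal_Power_Series"
begin

text \<open>Only meant for \<open>k > 0\<close>: the divisors of \<open>0\<close> form an infinite set, whose sum is \<open>0\<close> by convention.\<close>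

definition divisor_sigma :: "nat \<Rightarrow> nat" where
  "divisor_sigma k = (\<Sum>d | d dvd k. d)"

definition G :: "int fps" where
  "G = Abs_fps (\<lambda>k. if k = 0 then 0 else int (divisor_sigma k))"

definition fps_cong :: "int fps \<Rightarrow> int fps \<Rightarrow> int \<Rightarrow> bool" where
  "fps_cong F H m \<longleftrightarrow> (\<forall>n. [fps_nth F n = fps_nth H n] (mod m))"

text \<open>The library operator \<open>fps_XD\<close>, that is \<open>F \<mapsto> fps_X * fps_deriv F\<close>, is the operator \<open>D = q d/dq\<close>; it
acts termwise by \<open>fps_XD_nth\<close>.\<close>

end

theory Submission
  imports Defs
begin

text \<open>
  Write \<open>S\<close> for the sum of \<open>a * b\<close> over all positive solutions of \<open>a * x + b * y = n\<close>, which is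
  the \<open>n\<close>-th coefficient of \<open>G\<^sup>2\<close>. Since \<open>a * x + b * y = (a - b) * x + b * (x + y)\<close>, the
  solutions with \<open>b < a\<close> correspond to those with \<open>x < y\<close>. Applying this to the sums of
  \<open>(a + b)\<^sup>2\<close>, \<open>(a - b)\<^sup>2\<close> and \<open>a\<^sup>2\<close> reduces \<open>4 * S\<close> to the degenerate solutions with
  \<open>a = b\<close> or \<open>x = y\<close>, and these are sums over the divisors of \<open>n\<close>. The outcome is Besge's identity
  \<open>12 * S = 5 * \<sigma>\<^sub>3 n + (1 - 6 * n) * \<sigma> n\<close>, which gives the claim modulo 5. Modulo 2, only the
  middle term of the convolution survives, and \<open>\<sigma> (2 * m)\<close> and \<open>\<sigma> m\<close> have the same parity.
\<close>

section \<open>Weighted sums over the solutions and their symmetries\<close>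

definition sols :: "nat \<Rightarrow> (nat \<times> nat \<times> nat \<times> nat) set" where
  "sols n = {(a, b, x, y). 0 < a \<and> 0 < b \<and> 0 < x \<and> 0 < y \<and> a * x + b * y = n}"

lemma finite_sols: "finite (sols n)"
proof (rule finite_subset)
  show "sols n \<subseteq> {..n} \<times> {..n} \<times> {..n} \<times> {..n}"
  proof (clarsimp simp: sols_def)
    fix a b x y :: nat
    assume "0 < a" "0 < b" "0 < x" "0 < y"
    then have "a * 1 \<le> a * x" "1 * x \<le> a * x" "b * 1 \<le> b * y" "1 * y \<le> b * y"
      by (intro mult_le_mono; simp)+
    then show "a \<le> a * x + b * y \<and> b \<le> a * x + b * y \<and> x \<le> a * x + b * y \<and> y \<le> a * x + b * y"
      by linarith
  qed
qed simp

definition wsum :: "nat \<Rightarrow> (nat \<Rightarrow> nat \<Rightarrow> nat \<Rightarrow> nat \<Rightarrow> bool) \<Rightarrow> (nat \<Rightarrow> nat \<Rightarrow> int) \<Rightarrow> int" where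
  "wsum n P g = (\<Sum>(a, b, x, y) | (a, b, x, y) \<in> sols n \<and> P a b x y. g a b)"

lemma wsum_swap: "wsum n P g = wsum n (\<lambda>a b x y. P b a y x) (\<lambda>a b. g b a)"
  unfolding wsum_def
  by (rule sum.reindex_bij_witness[of _ "\<lambda>(a, b, x, y). (b, a, y, x)" "\<lambda>(a, b, x, y). (b, a, y, x)"])
    (auto simp: sols_def)

lemma wsum_cong:
  assumes "\<And>a b x y. (a, b, x, y) \<in> sols n \<Longrightarrow> P a b x y = Q a b x y"
    and "\<And>a b x y. (a, b, x, y) \<in> sols n \<Longrightarrow> Q a b x y \<Longrightarrow> g a b = h a b"
  shows "wsum n P g = wsum n Q h"
  unfolding wsum_def by (rule sum.cong) (use assms in auto)

lemma wsum_shift: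
  "wsum n (\<lambda>a b x y. b < a) g = wsum n (\<lambda>a b x y. x < y) (\<lambda>a b. g (a + b) b)"
proof -
  \<comment> \<open>The substitution and its inverse preserve \<open>n\<close>. Strictness makes the
    natural-number subtractions exact and keeps the new entries positive.\<close>
  have *: "(a - b) * x + b * (x + y) = a * x + b * y" if "b < a" for a b x y :: nat
    using that by (auto simp: less_iff_Suc_add algebra_simps)
  have **: "(a + b) * x + b * (y - x) = a * x + b * y" if "x < y" for a b x y :: nat
    using that by (auto simp: less_iff_Suc_add algebra_simps)
  show ?thesis
    unfolding wsum_def
    by (rule sum.reindex_bij_witness[of _ "\<lambda>(a, b, x, y). (a + b, b, x, y - x)"
          "\<lambda>(a, b, x, y). (a - b, b, x, x + y)"])
      (auto simp: sols_def * **)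
qed

lemma wsum_disj:
  assumes "\<And>a b x y. \<not> (P a b x y \<and> Q a b x y)"
  shows "wsum n (\<lambda>a b x y. P a b x y \<or> Q a b x y) g = wsum n P g + wsum n Q g"
  unfolding wsum_def
  by (subst sum.union_disjoint[symmetric])
    (use assms in \<open>auto intro!: sum.cong finite_subset[OF _ finite_sols[of n]]\<close>)

lemma wsum_trichotomy_ab:
  "wsum n (\<lambda>_ _ _ _. True) g
    = wsum n (\<lambda>a b x y. b < a) g + wsum n (\<lambda>a b x y. a = b) g + wsum n (\<lambda>a b x y. a < b) g"
proof -
  have "wsum n (\<lambda>_ _ _ _. True) g = wsum n (\<lambda>a b x y. (b < a \<or> a = b) \<or> a < b) g"
    by (rule wsum_cong) auto
  then show ?thesis by (simp add: wsum_disj)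
qed

lemma wsum_trichotomy_xy:
  "wsum n (\<lambda>_ _ _ _. True) g
    = wsum n (\<lambda>a b x y. x < y) g + wsum n (\<lambda>a b x y. x = y) g + wsum n (\<lambda>a b x y. y < x) g"
proof -
  have "wsum n (\<lambda>_ _ _ _. True) g = wsum n (\<lambda>a b x y. (x < y \<or> x = y) \<or> y < x) g"
    by (rule wsum_cong) auto
  then show ?thesis by (simp add: wsum_disj)
qed

text \<open>This is \<open>wsum_shift\<close> conjugated by \<open>wsum_swap\<close>. Now
  \<open>a\<close> stays fixed, so a weight in \<open>a\<close> alone is unchanged.\<close>

lemma wsum_shift':
  "wsum n (\<lambda>a b x y. a < b) g = wsum n (\<lambda>a b x y. y < x) (\<lambda>a b. g a (a + b))"
  using wsum_swap[of n "\<lambda>a b x y. a < b" g] wsum_shift[of n "\<lambda>a b. g b a"]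
    wsum_swap[of n "\<lambda>a b x y. y < x" "\<lambda>a b. g a (a + b)"]
  by (simp add: add.commute)

lemma wsum_add: "wsum n P (\<lambda>a b. g a b + h a b) = wsum n P g + wsum n P h"
  unfolding wsum_def by (subst sum.distrib[symmetric]) (auto intro!: sum.cong)

lemma wsum_cmult: "wsum n P (\<lambda>a b. c * g a b) = c * wsum n P g"
  unfolding wsum_def by (subst sum_distrib_left) (auto intro!: sum.cong)

text \<open>An instance of Liouville's method, with \<open>A\<close> and \<open>B\<close> below.
  Splitting by \<open>x\<close> against \<open>y\<close>, both off-diagonal parts of the sum of
  \<open>f (a + b)\<close> equal \<open>A\<close>; splitting by \<open>a\<close> against
  \<open>b\<close>, both off-diagonal parts of the sum of \<open>f (a - b)\<close> equal
  \<open>B\<close>, one of them by evenness. Splitting the sum of \<open>f a\<close> in both ways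
  gives the difference of \<open>A\<close> and \<open>B\<close>, because its parts over
  \<open>a < b\<close> and \<open>y < x\<close> agree.\<close>

lemma wsum_liouville:
  fixes f :: "int \<Rightarrow> int"
  assumes even: "\<And>u. f (- u) = f u"
  shows "wsum n (\<lambda>_ _ _ _. True) (\<lambda>a b. f (int a + int b))
      + wsum n (\<lambda>a b x y. a = b) (\<lambda>a b. f 0) + 2 * wsum n (\<lambda>a b x y. a = b) (\<lambda>a b. f (int a))
    = wsum n (\<lambda>_ _ _ _. True) (\<lambda>a b. f (int a - int b))
      + wsum n (\<lambda>a b x y. x = y) (\<lambda>a b. f (int a + int b))
      + 2 * wsum n (\<lambda>a b x y. x = y) (\<lambda>a b. f (int a))"
proof -
  define A where "A = wsum n (\<lambda>a b x y. b < a) (\<lambda>a b. f (int a))"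
  define B where "B = wsum n (\<lambda>a b x y. x < y) (\<lambda>a b. f (int a))"
  have "A + wsum n (\<lambda>a b x y. a = b) (\<lambda>a b. f (int a))
      = B + wsum n (\<lambda>a b x y. x = y) (\<lambda>a b. f (int a))"
    using wsum_trichotomy_ab[of n "\<lambda>a b. f (int a)"] wsum_trichotomy_xy[of n "\<lambda>a b. f (int a)"]
      wsum_shift'[of n "\<lambda>a b. f (int a)"]
    by (simp add: A_def B_def)
  moreover have "wsum n (\<lambda>_ _ _ _. True) (\<lambda>a b. f (int a + int b))
      = 2 * A + wsum n (\<lambda>a b x y. x = y) (\<lambda>a b. f (int a + int b))"
    using wsum_trichotomy_xy[of n "\<lambda>a b. f (int a + int b)"] wsum_shift[of n "\<lambda>a b. f (int a)"]
      wsum_swap[of n "\<lambda>a b x y. y < x" "\<lambda>a b. f (int a + int b)"]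
    by (simp add: A_def add.commute)
  moreover have "wsum n (\<lambda>_ _ _ _. True) (\<lambda>a b. f (int a - int b))
      = 2 * B + wsum n (\<lambda>a b x y. a = b) (\<lambda>a b. f 0)"
  proof -
    have "wsum n (\<lambda>a b x y. a < b) (\<lambda>a b. f (int a - int b))
        = wsum n (\<lambda>a b x y. b < a) (\<lambda>a b. f (int b - int a))"
      by (rule wsum_swap)
    also have "\<dots> = wsum n (\<lambda>a b x y. b < a) (\<lambda>a b. f (int a - int b))"
      by (rule wsum_cong) (use even in \<open>metis minus_diff_eq\<close>)+
    finally have "wsum n (\<lambda>a b x y. a < b) (\<lambda>a b. f (int a - int b)) = B"
      using wsum_shift[of n "\<lambda>a b. f (int a - int b)"] by (simp add: B_def)
    moreover have "wsum n (\<lambda>a b x y. b < a) (\<lambda>a b. f (int a - int b)) = B"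
      using wsum_shift[of n "\<lambda>a b. f (int a - int b)"] by (simp add: B_def)
    moreover have "wsum n (\<lambda>a b x y. a = b) (\<lambda>a b. f (int a - int b))
        = wsum n (\<lambda>a b x y. a = b) (\<lambda>a b. f 0)"
      by (rule wsum_cong) auto
    ultimately show ?thesis
      using wsum_trichotomy_ab[of n "\<lambda>a b. f (int a - int b)"] by simp
  qed
  ultimately show ?thesis by linarith
qed

section \<open>Degenerate solutions and Besge's identity\<close>

lemma wsum_eq_xy:
  assumes "n > 0"
  shows "wsum n (\<lambda>a b x y. x = y) g = (\<Sum>d | d dvd n. \<Sum>a = 1..<d. g a (d - a))"
proof -
  \<comment> \<open>If \<open>x = y\<close>, the equation reads \<open>(a + b) * x = n\<close>, so
    \<open>d = a + b\<close> is a divisor and \<open>a\<close> is any positive number below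
    it.\<close>
  have "wsum n (\<lambda>a b x y. x = y) g = (\<Sum>(d, a) \<in> (SIGMA d:{d. d dvd n}. {1..<d}). g a (d - a))"
    unfolding wsum_def
    by (rule sum.reindex_bij_witness[of _ "\<lambda>(d, a). (a, d - a, n div d, n div d)"
          "\<lambda>(a, b, x, y). (a + b, a)"])
      (use assms in \<open>auto simp: sols_def add_mult_distrib[symmetric] dvd_pos_nat\<close>)
  then show ?thesis using assms by (simp add: sum.Sigma)
qed

text \<open>With \<open>d = a = b\<close> the equation reads \<open>d * (x + y) = n\<close>, and the
  cofactor \<open>n div d\<close> splits into two positive summands in \<open>n div d - 1\<close>
  ways.\<close>

lemma wsum_eq_ab:
  assumes "n > 0"
  shows "wsum n (\<lambda>a b x y. a = b) g = (\<Sum>d | d dvd n. int (n div d - 1) * g d d)"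
proof -
  have "wsum n (\<lambda>a b x y. a = b) g = (\<Sum>(d, x) \<in> (SIGMA d:{d. d dvd n}. {1..<n div d}). g d d)"
    unfolding wsum_def
    by (rule sum.reindex_bij_witness[of _ "\<lambda>(d, x). (d, d, x, n div d - x)"
          "\<lambda>(a, b, x, y). (a, x)"])
      (use assms in \<open>auto simp: sols_def add_mult_distrib2[symmetric] dvd_pos_nat\<close>)
  also have "\<dots> = (\<Sum>d | d dvd n. \<Sum>x = 1..<n div d. g d d)"
    using assms by (subst sum.Sigma) auto
  finally show ?thesis by simp
qed

lemma sum_squares_less: "6 * (\<Sum>a = 1..<d. (int a)\<^sup>2) = 2 * int d ^ 3 - 3 * int d ^ 2 + int d"
proof (induction d)
  case (Suc d)
  then show ?case
    by (cases "d = 0") (simp_all add: algebra_simps power2_eq_square power3_eq_cube)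
qed simp

text \<open>Take \<open>f u = u^2\<close> in \<open>wsum_liouville\<close>; the factor 3 clears the
  denominator of the sum of squares. Per divisor this leaves \<open>3 * (d^3 - d^2) + (2 * d^3 - 3 *
  d^2 + d) - 6 * (n * d - d^2)\<close>, where the squares cancel.\<close>

lemma besge_wsum:
  assumes "n > 0"
  shows "12 * wsum n (\<lambda>_ _ _ _. True) (\<lambda>a b. int a * int b)
    = 5 * (\<Sum>d | d dvd n. int d ^ 3) + (1 - 6 * int n) * int (divisor_sigma n)"
proof -
  let ?T = "\<lambda>_ _ _ _. True"
  have "wsum n ?T (\<lambda>a b. (int a + int b)\<^sup>2)
      = wsum n ?T (\<lambda>a b. (int a - int b)\<^sup>2 + 4 * (int a * int b))"
    by (rule wsum_cong) (auto simp: power2_eq_square algebra_simps)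
  also have "\<dots> = wsum n ?T (\<lambda>a b. (int a - int b)\<^sup>2) + 4 * wsum n ?T (\<lambda>a b. int a * int b)"
    by (simp add: wsum_add wsum_cmult)
  finally have "12 * wsum n ?T (\<lambda>a b. int a * int b)
      = 3 * wsum n (\<lambda>a b x y. x = y) (\<lambda>a b. (int a + int b)\<^sup>2)
        + 6 * wsum n (\<lambda>a b x y. x = y) (\<lambda>a b. (int a)\<^sup>2)
        - 6 * wsum n (\<lambda>a b x y. a = b) (\<lambda>a b. (int a)\<^sup>2)"
    \<comment> \<open>The zero instance of \<open>wsum_cmult\<close> removes the term with
      \<open>f 0 = 0\<close>.\<close>
    using wsum_liouville[of "\<lambda>u. u\<^sup>2" n] wsum_cmult[of n "\<lambda>a b x y. a = b" 0 "\<lambda>a b. 0"]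
    by simp
  also have "wsum n (\<lambda>a b x y. x = y) (\<lambda>a b. (int a + int b)\<^sup>2)
      = (\<Sum>d | d dvd n. int d ^ 3 - int d ^ 2)"
    unfolding wsum_eq_xy[OF assms]
  proof (rule sum.cong)
    fix d assume "d \<in> {d. d dvd n}"
    then have "d > 0" using assms by (auto intro: Nat.gr0I)
    have "(\<Sum>a = 1..<d. (int a + int (d - a))\<^sup>2) = (\<Sum>a = 1..<d. (int d)\<^sup>2)"
      by (rule sum.cong) auto
    also have "\<dots> = int d ^ 3 - int d ^ 2"
      using \<open>d > 0\<close> by (simp add: of_nat_diff algebra_simps power2_eq_square power3_eq_cube)
    finally show "(\<Sum>a = 1..<d. (int a + int (d - a))\<^sup>2) = int d ^ 3 - int d ^ 2" .
  qed simp
  also have "6 * wsum n (\<lambda>a b x y. x = y) (\<lambda>a b. (int a)\<^sup>2)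
      = (\<Sum>d | d dvd n. 2 * int d ^ 3 - 3 * int d ^ 2 + int d)"
    unfolding wsum_eq_xy[OF assms] sum_distrib_left[of 6 _ "{d. d dvd n}"] sum_squares_less ..
  also have "wsum n (\<lambda>a b x y. a = b) (\<lambda>a b. (int a)\<^sup>2)
      = (\<Sum>d | d dvd n. int n * int d - int d ^ 2)"
    unfolding wsum_eq_ab[OF assms]
  proof (rule sum.cong)
    fix d assume "d \<in> {d. d dvd n}"
    then obtain k where k: "n = d * k" by auto
    then have "d > 0" "k > 0" using assms by auto
    then show "int (n div d - 1) * (int d)\<^sup>2 = int n * int d - int d ^ 2"
      by (simp add: k of_nat_diff algebra_simps power2_eq_square)
  qed simp
  finally show ?thesis
    unfolding divisor_sigma_def sum.distrib sum_subtractf sum_distrib_left[symmetric]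
    by (simp add: algebra_simps)
qed

section \<open>Coefficients of \<open>G\<close> and \<open>G^2\<close>, and their parity\<close>

lemma G_nth: "fps_nth G n = int (divisor_sigma n)"
  \<comment> \<open>This covers \<open>n = 0\<close> too: the sum over the infinite set of divisors
    of 0 is 0.\<close>
  by (simp add: G_def divisor_sigma_def)

lemma G_square_nth:
  "fps_nth (G\<^sup>2) n = wsum n (\<lambda>_ _ _ _. True) (\<lambda>a b. int a * int b)"
proof -
  let ?D = "\<lambda>i::nat. {d. d dvd i}"
  have "fps_nth (G\<^sup>2) n = (\<Sum>i = 0..n. fps_nth G i * fps_nth G (n - i))"
    by (simp add: power2_eq_square fps_mult_nth)
  \<comment> \<open>Dropping the vanishing end terms leaves only finite divisor sets, as
    \<open>sum.Sigma\<close> requires.\<close>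
  also have "\<dots> = (\<Sum>i = 1..<n. fps_nth G i * fps_nth G (n - i))"
    by (rule sum.mono_neutral_right) (auto simp: G_def)
  also have "\<dots> = (\<Sum>i = 1..<n. \<Sum>(a, b) \<in> ?D i \<times> ?D (n - i). int a * int b)"
    by (simp add: G_nth divisor_sigma_def sum_product sum.cartesian_product)
  also have "\<dots> = (\<Sum>(i, a, b) \<in> (SIGMA i:{1..<n}. ?D i \<times> ?D (n - i)). int a * int b)"
    by (subst sum.Sigma) auto
  \<comment> \<open>Here \<open>i = a * x\<close>, and \<open>x\<close>, \<open>y\<close> are the
    cofactors of \<open>a\<close> in \<open>i\<close> and of \<open>b\<close> in
    \<open>n - i\<close>.\<close>
  also have "\<dots> = wsum n (\<lambda>_ _ _ _. True) (\<lambda>a b. int a * int b)"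
    unfolding wsum_def
    by (rule sum.reindex_bij_witness[of _ "\<lambda>(a, b, x, y). (a * x, a, b)"
          "\<lambda>(i, a, b). (a, b, i div a, (n - i) div b)"])
      (auto simp: sols_def intro!: Nat.gr0I simp: dvd_div_eq_0_iff)
  finally show ?thesis .
qed

text \<open>The involution taking \<open>i\<close> to \<open>n - i\<close> pairs equal terms; a
  middle term is a square \<open>c^2\<close>, which has the parity of \<open>c\<close>.\<close>

lemma convolution_square_parity:
  fixes c :: "nat \<Rightarrow> int"
  shows "even ((\<Sum>i = 0..n. c i * c (n - i)) - (if even n then c (n div 2) else 0))"
proof -
  have "(\<Sum>i = 0..n. c i * c (n - i))
      = (\<Sum>i | i \<le> n \<and> 2 * i < n. c i * c (n - i)) + (\<Sum>i | i \<le> n \<and> n < 2 * i. c i * c (n - i))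
        + (\<Sum>i | 2 * i = n. c i * c (n - i))"
    by (subst sum.union_disjoint[symmetric]; (subst sum.union_disjoint[symmetric])?)
      (auto intro!: sum.cong intro: finite_subset[of _ "{..n}"])
  also have "(\<Sum>i | i \<le> n \<and> n < 2 * i. c i * c (n - i)) = (\<Sum>i | i \<le> n \<and> 2 * i < n. c i * c (n - i))"
    by (rule sum.reindex_bij_witness[of _ "\<lambda>i. n - i" "\<lambda>i. n - i"]) auto
  also have "(\<Sum>i | 2 * i = n. c i * c (n - i)) = (if even n then c (n div 2) * c (n div 2) else 0)"
  proof (cases "even n")
    case True
    then obtain m where "n = 2 * m" by blast
    then show ?thesis by simp
  next
    case False
    then have "{i. 2 * i = n} = {}" by auto
    then show ?thesis using False by simp
  qed
  finally show ?thesis by auto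
qed

lemma divisor_sigma_double_parity:
  assumes "m > 0"
  shows "even (divisor_sigma (2 * m)) \<longleftrightarrow> even (divisor_sigma m)"
proof -
  have "{d. d dvd 2 * m} = {d. d dvd m} \<union> {d. d dvd 2 * m \<and> \<not> d dvd m}"
    by auto
  then have "divisor_sigma (2 * m) = divisor_sigma m + (\<Sum>d | d dvd 2 * m \<and> \<not> d dvd m. d)"
    unfolding divisor_sigma_def using assms
    by (subst sum.union_disjoint[symmetric]) auto
  \<comment> \<open>An odd divisor of \<open>2 * m\<close> is coprime to 2, hence already divides
    \<open>m\<close>.\<close>
  moreover have "even (\<Sum>d | d dvd 2 * m \<and> \<not> d dvd m. d)"
  proof (rule dvd_sum)
    fix d assume "d \<in> {d. d dvd 2 * m \<and> \<not> d dvd m}"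
    then show "even d"
      by (metis (mono_tags) coprime_dvd_mult_right_iff coprime_right_2_iff_odd mem_Collect_eq)
  qed
  ultimately show ?thesis by simp
qed

theorem theorem3p2:
  shows "fps_cong (7 * G\<^sup>2 - G + fps_XD G) 0 10"
  unfolding fps_cong_def
proof
  fix n
  define S where "S = fps_nth (G\<^sup>2) n"
  define s where "s = fps_nth G n"
  have coeff: "fps_nth (7 * G\<^sup>2 - G + fps_XD G) n = 7 * S - s + int n * s"
    by (simp add: S_def s_def fps_XD_nth numeral_fps_const)
  show "[fps_nth (7 * G\<^sup>2 - G + fps_XD G) n = fps_nth 0 n] (mod 10)"
  proof (cases "n = 0")
    case True
    then have "S = 0" "s = 0" by (simp_all add: S_def s_def G_def power2_eq_square)
    then show ?thesis unfolding coeff by simp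
  next
    case False
    have "12 * S = 5 * (\<Sum>d | d dvd n. int d ^ 3) + (1 - 6 * int n) * s"
      using besge_wsum[of n] False by (simp add: S_def s_def G_nth G_square_nth)
    \<comment> \<open>Besge's identity with \<open>5 * S + 5 * n * s\<close> moved to the
      right.\<close>
    then have "7 * S - s + int n * s = 5 * ((\<Sum>d | d dvd n. int d ^ 3) - S - int n * s)"
      by (simp add: algebra_simps)
    then have 5: "5 dvd 7 * S - s + int n * s" by (metis dvd_triv_left)
    have S: "even (S - (if even n then fps_nth G (n div 2) else 0))"
      using convolution_square_parity[of "fps_nth G" n]
      by (simp add: S_def power2_eq_square fps_mult_nth)
    \<comment> \<open>For \<open>n = 2 * m\<close>, both \<open>S\<close> and \<open>s\<close> have
      the parity of the divisor sum of \<open>m\<close>, and \<open>n * s\<close> is even. For odd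
      \<open>n\<close>, both \<open>S\<close> and \<open>(n - 1) * s\<close> are even.\<close>
    have 2: "even (7 * S - s + int n * s)"
    proof (cases "even n")
      case True
      then obtain m where "n = 2 * m" by blast
      then show ?thesis
        using S False divisor_sigma_double_parity[of m] by (auto simp: s_def G_nth)
    next
      case False
      then show ?thesis using S by auto
    qed
    have "2 * 5 dvd 7 * S - s + int n * s"
      by (rule divides_mult[OF 2 5]) (simp add: coprime_left_2_iff_odd)
    then show ?thesis unfolding coeff by (simp add: cong_0_iff)
  qed
qed

end
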